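(* If $(X,\lambda)$ is a convergence approach space and $\lambda_{lK}$ and $\lambda_{lV}$ denote the corresponding lower Kuratowski and lower Vietoris convergence approach structures on $\mathcal{C}_{c(\lambda)}$, then $$\lambda_{lK}\geq\lambda_{lV}.$$ Moreover, this is an equality if $(X,\lambda)$ is an approach space.
   Context: $\mathbb{F}X$ is the set of (proper) filters on $X$, $\mathbb{P}X$ the powerset; $\mathcal{F}\leq\mathcal{G}$ means $\mathcal{F}\subset\mathcal{G}$. For $\mathcal{A}\subset\mathbb{P}X$, $\mathcal{A}^{\#}=\{B\subset X:\forall A\in\mathcal{A},\ A\cap B\neq\emptyset\}$; $\mathcal{A}\#\mathcal{B}$ means $\mathcal{A}\subset\mathcal{B}^{\#}$; $\{x\}^{\uparrow}$ is the principal ultrafilter of $x$. Infimum of $\emptyset$ is $\infty$, supremum of $\emptyset$ is $0$. A convergence approach space is $(X,\lambda)$ with $\lambda:\mathbb{F}X\to[0,\infty]^{X}$ such that $\mathcal{F}\leq\mathcal{G}$ implies $\lambda(\mathcal{F})\geq\lambda(\mathcal{G})$ pointwise, and $\lambda(\{x\}^{\uparrow})(x)=0$ for all $x$. It is a pre-approach space if $\lambda(\bigcap_{\mathcal{D}\in\mathbb{D}}\mathcal{D})=\bigvee_{\mathcal{D}\in\mathbb{D}}\lambda(\mathcal{D})$ for every (nonempty) $\mathbb{D}\subset\mathbb{F}X$. For $\mathcal{F}\subset\mathbb{P}X$, $\operatorname{adh}_\lambda\mathcal{F}(x)=\bigwedge\{\lambda(\mathcal{G})(x):\mathcal{G}\in\mathbb{F}X,\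 \mathcal{G}\#\mathcal{F}\}$; for $A\subset X$, $\operatorname{adh}_\lambda A=\operatorname{adh}_\lambda\{A\}$ and $A^{(\epsilon)}=\{x:\operatorname{adh}_\lambda A(x)\leq\epsilon\}$. An approach space is a pre-approach space such that $\operatorname{adh}_\lambda A\leq\operatorname{adh}_\lambda A^{(\epsilon)}+\epsilon$ for all $A\subset X$, $\epsilon\in[0,\infty]$. A contraction $f:(X,\lambda_X)\to(Y,\lambda_Y)$ is a map with $\lambda_Y(f[\mathcal{F}])(f(x))\leq\lambda_X(\mathcal{F})(x)$ for all $\mathcal{F}\in\mathbb{F}X$, $x\in X$, where $f[\mathcal{F}]$ is the image filter. The convergence $c(\lambda)$: $x\in\lim_{c(\lambda)}\mathcal{F}\iff\lambda(\mathcal{F})(x)=0$; $A$ is $c(\lambda)$-closed if $A\in\mathcal{F}$ implies $\lim_{c(\lambda)}\mathcal{F}\subset A$; $\mathcal{C}_{c(\lambda)}$ is the set of $c(\lambda)$-closed sets. For a filter $\mathfrak{F}$ on $\mathcal{C}_{c(\lambda)}$ with grill $\mathfrak{F}^{\#}$ (in $\mathcal{C}_{c(\lambda)}$), $\operatorname{rdc}(\mathfrak{F}^{\#})=\{\bigcup_{C\in\mathcal{H}}C:\mathcal{H}\in\mathfrak{F}^{\#}\}$ and $\lambda_{lK}\mathfrak{F}(A)=\bigvee_{x\in A}\operatorname{adh}_\lambda(\operatorname{rdc}(\mathfrak{F}^{\#}))(x)$ for $A\in\mathcal{C}_{c(\lambda)}$. Truncated difference on $[0,\infty]$: $x\ominus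 y=(x-y)\vee0$ for $x,y<\infty$; $\infty\ominus y=\infty$ for $y\neq\infty$; $x\ominus\infty=0$. The canonical approach structure on $[0,\infty]$ is $\lambda_V(\mathcal{F})(v)=v\ominus\bigwedge_{A\in\mathcal{F}^{\#}}\bigvee A$. Let $\mathcal{L}$ be the set of contractions $(X,\lambda)\to([0,\infty],\lambda_V)$. For $\mu\in\mathcal{L}$ let $\mu^{\vee}:\mathcal{C}_{c(\lambda)}\to[0,\infty]$, $\mu^{\vee}(A)=\bigvee\mu(A)=\sup_{x\in A}\mu(x)$. The lower Vietoris (Vietoris $\vee$-) approach structure is the one generated by the functions $\mu^\vee$ (with lower regular function frame $\mathcal{L}^{\vee}=\{\sup_{j\in J}\inf_{k\in K_j}\mu_{j,k}^{\vee}:K_j\text{ finite},\mu_{j,k}\in\mathcal{L}\}$), and its limit operator is $$\lambda_{lV}\mathfrak{F}(A)=\bigvee_{\mu\in\mathcal{L}}\Big(\mu^{\vee}(A)\ominus\bigvee_{\mathcal{A}\in\mathfrak{F}}\bigwedge_{C\in\mathcal{A}}\mu^{\vee}(C)\Big).$$ Inequalities between structures are pointwise: $\lambda_{lK}\mathfrak{F}(A)\geq\lambda_{lV}\mathfrak{F}(A)$ for every filter $\mathfrak{F}$ on $\mathcal{C}_{c(\lambda)}$ and $A\in\mathcal{C}_{c(\lambda)}$. *)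

theory Defs
  imports "HOL-Library.Extended_Nonnegative_Real"
begin

text \<open>
  A proper filter on a set \<open>S\<close> is encoded as a filter on the ambient type that is not \<^term>\<open>bot\<close>
  and contains \<open>S\<close>; the corresponding family of subsets of \<open>S\<close> is \<open>filter_sets S F\<close>.
  The library order on filters is the reverse of inclusion of these families (see
  \<open>filter_sets_subset_iff\<close> below), and \<^term>\<open>Sup\<close> of a set of filters is their intersection.
\<close>

definition filters_on :: "'a set \<Rightarrow> 'a filter set" where
  "filters_on S = {F. F \<noteq> bot \<and> F \<le> principal S}"

definition filter_sets :: "'a set \<Rightarrow> 'a filter \<Rightarrow> 'a set set" where
  "filter_sets S F = {A. A \<subseteq> S \<and> eventually (\<lambda>x. x \<in> A) F}"

lemma filter_sets_subset_iff:
  assumes "F \<in> filters_on S" "G \<in> filters_on S"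
  shows "filter_sets S F \<subseteq> filter_sets S G \<longleftrightarrow> G \<le> F"
proof
  assume sub: "filter_sets S F \<subseteq> filter_sets S G"
  show "G \<le> F"
  proof (rule filter_leI)
    fix P assume "eventually P F"
    moreover have "eventually (\<lambda>x. x \<in> S) F"
      using assms(1) by (simp add: filters_on_def le_principal)
    ultimately have "{x \<in> S. P x} \<in> filter_sets S F"
      by (auto simp: filter_sets_def eventually_conj_iff)
    with sub have "{x \<in> S. P x} \<in> filter_sets S G" by blast
    then show "eventually P G"
      by (auto simp: filter_sets_def elim: eventually_mono)
  qed
qed (auto simp: filter_sets_def dest: filter_leD)

lemma filter_sets_surj:
  fixes \<F> :: "'a set set"
  assumes "\<F> \<subseteq> Pow S" "S \<in> \<F>" "{} \<notin> \<F>"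
    and "\<And>A B. A \<in> \<F> \<Longrightarrow> B \<in> \<F> \<Longrightarrow> A \<inter> B \<in> \<F>"
    and "\<And>A B. A \<in> \<F> \<Longrightarrow> A \<subseteq> B \<Longrightarrow> B \<subseteq> S \<Longrightarrow> B \<in> \<F>"
  shows "\<exists>F\<in>filters_on S. filter_sets S F = \<F>"
proof -
  define F where "F = (INF A\<in>\<F>. principal A)"
  have ev: "eventually P F \<longleftrightarrow> (\<exists>A\<in>\<F>. \<forall>x\<in>A. P x)" for P
    unfolding F_def
    by (subst eventually_INF_base)
       (use assms(2,4) in \<open>auto simp: eventually_principal intro!: bexI[of _ "_ \<inter> _"]\<close>)
  have "F \<in> filters_on S"
    using assms(2,3)
    by (auto simp: filters_on_def le_principal ev trivial_limit_def)
  moreover have "filter_sets S F = \<F>"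
    using assms(1,5) by (auto simp: filter_sets_def ev) blast+
  ultimately show ?thesis by blast
qed

definition grill :: "'a set \<Rightarrow> 'a set set \<Rightarrow> 'a set set" where
  "grill S \<A> = {B. B \<subseteq> S \<and> (\<forall>A\<in>\<A>. A \<inter> B \<noteq> {})}"

definition mesh :: "'a set \<Rightarrow> 'a set set \<Rightarrow> 'a set set \<Rightarrow> bool" where
  "mesh S \<A> \<B> \<longleftrightarrow> \<A> \<subseteq> grill S \<B>"

locale convergence_approach_space =
  fixes X :: "'a set" and lam :: "'a filter \<Rightarrow> 'a \<Rightarrow> ennreal"
  assumes antitone:
      "\<And>F G x. F \<in> filters_on X \<Longrightarrow> G \<in> filters_on X \<Longrightarrow>
        filter_sets X F \<subseteq> filter_sets X G \<Longrightarrow> x \<in> X \<Longrightarrow> lam G x \<le> lam F x"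
    and point: "\<And>x. x \<in> X \<Longrightarrow> lam (principal {x}) x = 0"

locale pre_approach_space = convergence_approach_space +
  assumes Sup_filters:
    "\<And>D x. D \<noteq> {} \<Longrightarrow> D \<subseteq> filters_on X \<Longrightarrow> x \<in> X \<Longrightarrow> lam (Sup D) x = (SUP F\<in>D. lam F x)"

definition adh :: "'a set \<Rightarrow> ('a filter \<Rightarrow> 'a \<Rightarrow> ennreal) \<Rightarrow> 'a set set \<Rightarrow> 'a \<Rightarrow> ennreal" where
  "adh X lam \<A> x = (INF G\<in>{G \<in> filters_on X. mesh X (filter_sets X G) \<A>}. lam G x)"

definition enlargement ::
  "'a set \<Rightarrow> ('a filter \<Rightarrow> 'a \<Rightarrow> ennreal) \<Rightarrow> 'a set \<Rightarrow> ennreal \<Rightarrow> 'a set" where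
  "enlargement X lam A \<epsilon> = {x \<in> X. adh X lam {A} x \<le> \<epsilon>}"

locale approach_space = pre_approach_space +
  assumes adh_enlargement:
    "\<And>A \<epsilon> x. A \<subseteq> X \<Longrightarrow> x \<in> X \<Longrightarrow> adh X lam {A} x \<le> adh X lam {enlargement X lam A \<epsilon>} x + \<epsilon>"

definition contraction ::
  "'a set \<Rightarrow> ('a filter \<Rightarrow> 'a \<Rightarrow> ennreal) \<Rightarrow> 'b set \<Rightarrow> ('b filter \<Rightarrow> 'b \<Rightarrow> ennreal) \<Rightarrow>
    ('a \<Rightarrow> 'b) \<Rightarrow> bool" where
  "contraction X lamX Y lamY f \<longleftrightarrow>
    f ` X \<subseteq> Y \<and> (\<forall>F\<in>filters_on X. \<forall>x\<in>X. lamY (filtermap f F) (f x) \<le> lamX F x)"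

definition lim_c :: "'a set \<Rightarrow> ('a filter \<Rightarrow> 'a \<Rightarrow> ennreal) \<Rightarrow> 'a filter \<Rightarrow> 'a set" where
  "lim_c X lam F = {x \<in> X. lam F x = 0}"

definition closed_sets :: "'a set \<Rightarrow> ('a filter \<Rightarrow> 'a \<Rightarrow> ennreal) \<Rightarrow> 'a set set" where
  "closed_sets X lam =
    {A. A \<subseteq> X \<and> (\<forall>F\<in>filters_on X. A \<in> filter_sets X F \<longrightarrow> lim_c X lam F \<subseteq> A)}"

definition rdc :: "'a set set set \<Rightarrow> 'a set set" where
  "rdc \<HH> = {\<Union>\<H> |\<H>. \<H> \<in> \<HH>}"

definition lower_Kuratowski ::
  "'a set \<Rightarrow> ('a filter \<Rightarrow> 'a \<Rightarrow> ennreal) \<Rightarrow> 'a set filter \<Rightarrow> 'a set \<Rightarrow> ennreal" where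
  "lower_Kuratowski X lam \<FF> A =
    (let \<C> = closed_sets X lam in
      SUP x\<in>A. adh X lam (rdc (grill \<C> (filter_sets \<C> \<FF>))) x)"

text \<open>The library's subtraction satisfies \<open>top - top = top\<close>, whereas here \<open>top \<ominus> top = 0\<close>.\<close>

definition tminus :: "ennreal \<Rightarrow> ennreal \<Rightarrow> ennreal"  (infixl \<open>\<ominus>\<close> 65) where
  "x \<ominus> y = (if y = top then 0 else x - y)"

definition lam_V :: "ennreal filter \<Rightarrow> ennreal \<Rightarrow> ennreal" where
  "lam_V F v = v \<ominus> (INF A\<in>grill UNIV (filter_sets UNIV F). Sup A)"

definition contractions_V :: "'a set \<Rightarrow> ('a filter \<Rightarrow> 'a \<Rightarrow> ennreal) \<Rightarrow> ('a \<Rightarrow> ennreal) set" where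
  "contractions_V X lam = {\<mu>. contraction X lam UNIV lam_V \<mu>}"

definition vee :: "('a \<Rightarrow> ennreal) \<Rightarrow> 'a set \<Rightarrow> ennreal" where
  "vee \<mu> A = (SUP x\<in>A. \<mu> x)"

text \<open>
  The limit operator of the approach structure on the closed sets generated by the functions
  \<open>vee \<mu>\<close>, where \<open>\<mu>\<close> ranges over the contractions into \<open>([0, \<infinity>], lam_V)\<close>.
\<close>

definition lower_Vietoris ::
  "'a set \<Rightarrow> ('a filter \<Rightarrow> 'a \<Rightarrow> ennreal) \<Rightarrow> 'a set filter \<Rightarrow> 'a set \<Rightarrow> ennreal" where
  "lower_Vietoris X lam \<FF> A =
    (SUP \<mu>\<in>contractions_V X lam.
      vee \<mu> A \<ominus> (SUP \<A>\<in>filter_sets (closed_sets X lam) \<FF>. INF C\<in>\<A>. vee \<mu> C))"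

end

(*
  A contraction mu into [0, infinity] is a function that is lower semicontinuous up to the error
  lam G x. For the inequality, t > sup_{A in F} inf_{C in A} vee mu C makes the family of closed
  sets C with vee mu C < t a member of the grill of F, so its union meets every filter G occurring
  in the adherence, and lower semicontinuity bounds mu x.

  For equality, fix r above the lower Vietoris value and let G be the coarsest filter with
  lam G x \<le> r, which exists in a pre-approach space. If U belongs to G, then the distance to the
  complement of U is at least r at x. In an approach space this distance is a contraction, so it is
  a test function for the Vietoris structure; hence it is not identically zero on the members C of
  some element of F, i.e. all these C meet U. Thus G meshes with the reduced grill.
*)
theory Submission imports Defs begin

lemma tminus_le_iff: "x \<ominus> y \<le> z \<longleftrightarrow> y = top \<or> x \<le> z + y"
  by (auto simp: tminus_def ennreal_minus_le_iff add.commute)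

lemma tminus_antimono: "y \<le> y' \<Longrightarrow> x \<ominus> y' \<le> x \<ominus> y"
  by (auto simp: tminus_def top_unique intro: ennreal_mono_minus)

lemma lower_semicontinuous_lam_V:
  assumes "contraction X lam UNIV lam_V \<mu>" "G \<in> filters_on X" "x \<in> X"
    and meets: "\<And>t. s < t \<Longrightarrow> \<exists>D. vee \<mu> D \<le> t \<and> (\<forall>B\<in>filter_sets X G. B \<inter> D \<noteq> {})"
  shows "\<mu> x \<ominus> s \<le> lam G x"
proof -
  let ?L = "INF D\<in>grill UNIV (filter_sets UNIV (filtermap \<mu> G)). Sup D"
  have "?L \<le> s"
  proof (rule dense_ge)
    fix t assume "s < t"
    from meets[OF this] obtain D
      where D: "vee \<mu> D \<le> t" "\<forall>B\<in>filter_sets X G. B \<inter> D \<noteq> {}" by blast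
    have "E \<inter> \<mu> ` D \<noteq> {}" if "eventually (\<lambda>v. v \<in> E) (filtermap \<mu> G)" for E
    proof -
      \<comment> \<open>The preimage is cut down to \<open>X\<close> because
        \<open>filter_sets X G\<close> consists of subsets of \<open>X\<close>.\<close>
      have "{y \<in> X. \<mu> y \<in> E} \<in> filter_sets X G"
        using that assms(2)
        by (auto simp: filter_sets_def filters_on_def le_principal eventually_filtermap
            eventually_conj_iff)
      with D(2) have "{y \<in> X. \<mu> y \<in> E} \<inter> D \<noteq> {}" by (rule bspec)
      then show ?thesis by auto
    qed
    then have "\<mu> ` D \<in> grill UNIV (filter_sets UNIV (filtermap \<mu> G))"
      by (auto simp: grill_def filter_sets_def)
    then have "?L \<le> Sup (\<mu> ` D)" by (rule INF_lower)
    with D(1) show "?L \<le> t" by (simp add: vee_def)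
  qed
  then have "\<mu> x \<ominus> s \<le> \<mu> x \<ominus> ?L" by (rule tminus_antimono)
  also have "\<dots> = lam_V (filtermap \<mu> G) (\<mu> x)" by (simp add: lam_V_def)
  also have "\<dots> \<le> lam G x" using assms(1-3) by (auto simp: contraction_def)
  finally show ?thesis .
qed

lemma closed_sets_subset: "A \<in> closed_sets X lam \<Longrightarrow> A \<subseteq> X"
  by (simp add: closed_sets_def)

lemma lower_Vietoris_le_lower_Kuratowski:
  assumes "A \<in> closed_sets X lam"
  shows "lower_Vietoris X lam \<FF> A \<le> lower_Kuratowski X lam \<FF> A"
  unfolding lower_Vietoris_def
proof (rule SUP_least)
  fix \<mu> assume "\<mu> \<in> contractions_V X lam"
  then have \<mu>: "contraction X lam UNIV lam_V \<mu>" by (simp add: contractions_V_def)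
  let ?C = "closed_sets X lam"
  let ?R = "rdc (grill ?C (filter_sets ?C \<FF>))"
  define s where "s = (SUP \<A>\<in>filter_sets ?C \<FF>. INF C\<in>\<A>. vee \<mu> C)"
  have "\<mu> x \<ominus> s \<le> lower_Kuratowski X lam \<FF> A" if "x \<in> A" for x
  proof -
    have "x \<in> X" using that assms closed_sets_subset by blast
    have "\<mu> x \<ominus> s \<le> adh X lam ?R x"
      unfolding adh_def
    proof (rule INF_greatest, clarify)
      fix G assume G: "G \<in> filters_on X" and m: "mesh X (filter_sets X G) ?R"
      show "\<mu> x \<ominus> s \<le> lam G x"
      proof (rule lower_semicontinuous_lam_V[OF \<mu> G \<open>x \<in> X\<close>])
        fix t assume "s < t"
        \<comment> \<open>The strict bound matters: an infimum over \<A> below \<open>t\<close>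
          yields a member of \<A> in \<H>, which puts \<H> in the grill. On the union only the weak
          bound by \<open>t\<close> survives.\<close>
        define \<H> where "\<H> = {C \<in> ?C. vee \<mu> C < t}"
        have "\<A> \<inter> \<H> \<noteq> {}" if "\<A> \<in> filter_sets ?C \<FF>" for \<A>
        proof -
          have "(INF C\<in>\<A>. vee \<mu> C) \<le> s" unfolding s_def using that by (rule SUP_upper)
          then have "(INF C\<in>\<A>. vee \<mu> C) < t" using \<open>s < t\<close> by simp
          then show ?thesis using that by (auto simp: INF_less_iff \<H>_def filter_sets_def)
        qed
        then have "\<Union>\<H> \<in> ?R" by (auto simp: rdc_def grill_def \<H>_def)
        then have "\<forall>B\<in>filter_sets X G. B \<inter> \<Union>\<H> \<noteq> {}"
          using m unfolding mesh_def grill_def by blast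
        moreover have "vee \<mu> (\<Union>\<H>) \<le> t"
          unfolding vee_def by (rule SUP_least)
            (auto simp: \<H>_def vee_def intro: order.trans[OF SUP_upper less_imp_le])
        ultimately show "\<exists>D. vee \<mu> D \<le> t \<and> (\<forall>B\<in>filter_sets X G. B \<inter> D \<noteq> {})" by blast
      qed
    qed
    also have "\<dots> \<le> lower_Kuratowski X lam \<FF> A"
      unfolding lower_Kuratowski_def Let_def using that by (rule SUP_upper)
    finally show ?thesis .
  qed
  \<comment> \<open>By residuation, subtracting \<open>s\<close> becomes adding \<open>s\<close> on
    the right, so the pointwise bounds pass to the supremum over \<open>A\<close>.\<close>
  then have "vee \<mu> A \<ominus> s \<le> lower_Kuratowski X lam \<FF> A"
    unfolding tminus_le_iff vee_def by (auto intro: SUP_least)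
  then show "vee \<mu> A \<ominus> (SUP \<A>\<in>filter_sets ?C \<FF>. INF C\<in>\<A>. vee \<mu> C)
      \<le> lower_Kuratowski X lam \<FF> A"
    by (simp add: s_def)
qed

lemma (in convergence_approach_space) adh_eq_0:
  assumes "B \<subseteq> X" "x \<in> B"
  shows "adh X lam {B} x = 0"
proof -
  have "principal {x} \<in> {G \<in> filters_on X. mesh X (filter_sets X G) {B}}"
    using assms
    by (auto simp: filters_on_def mesh_def grill_def filter_sets_def eventually_principal
        principal_eq_bot_iff)
  then have "adh X lam {B} x \<le> lam (principal {x}) x" unfolding adh_def by (rule INF_lower)
  then show ?thesis using point assms by auto
qed

text \<open>A filter meshing with \<open>B\<close> has a proper trace on \<open>B\<close>; the trace
  is finer, so \<open>antitone\<close> keeps its \<open>lam\<close> value below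
  \<open>r\<close>.\<close>

lemma (in convergence_approach_space) filter_containing_of_adh_less:
  assumes "B \<subseteq> X" "x \<in> X" "adh X lam {B} x < r"
  obtains G where "G \<in> filters_on X" "eventually (\<lambda>y. y \<in> B) G" "lam G x < r"
proof -
  from assms(3) obtain G where G: "G \<in> filters_on X" "mesh X (filter_sets X G) {B}" "lam G x < r"
    by (auto simp: adh_def INF_less_iff)
  let ?G = "inf G (principal B)"
  have "?G \<noteq> bot"
  proof
    assume "?G = bot"
    then have "eventually (\<lambda>y. y \<in> B \<longrightarrow> False) G"
      by (simp add: trivial_limit_def eventually_inf_principal)
    then have "X - B \<in> filter_sets X G"
      using G(1) by (auto simp: filter_sets_def filters_on_def le_principal eventually_conj_iff)
    then show False using G(2) by (auto simp: mesh_def grill_def)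
  qed
  then have fil: "?G \<in> filters_on X"
    using G(1) by (auto simp: filters_on_def intro: le_infI1)
  then have "lam ?G x \<le> lam G x"
    using G(1) assms(2) by (intro antitone) (simp_all add: filter_sets_subset_iff)
  then show thesis
    using that[OF fil] G(3) by (simp add: eventually_inf_principal)
qed

text \<open>For \<open>t\<close> above the infimum \<open>?L\<close>, some grill member has supremum
  below \<open>t\<close>, so the sublevel set of \<open>?\<mu>\<close> at \<open>t\<close> meshes
  with \<open>G\<close>. This sublevel set is the enlargement of \<open>B\<close> by
  \<open>t\<close>, and the enlargement axiom gives \<open>?\<mu> x \<le> lam G x + t\<close>. Then
  \<open>t\<close> tends to \<open>?L\<close>.\<close>

lemma (in approach_space) contraction_adh:
  assumes "B \<subseteq> X"
  shows "contraction X lam UNIV lam_V (adh X lam {B})"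
  unfolding contraction_def
proof (intro conjI ballI)
  fix G x assume G: "G \<in> filters_on X" and "x \<in> X"
  let ?\<mu> = "adh X lam {B}"
  let ?L = "INF D\<in>grill UNIV (filter_sets UNIV (filtermap ?\<mu> G)). Sup D"
  have "?\<mu> x \<le> lam G x + t" if "?L < t" for t
  proof -
    from that obtain D where D: "D \<in> grill UNIV (filter_sets UNIV (filtermap ?\<mu> G))" "Sup D < t"
      by (auto simp: INF_less_iff)
    let ?E = "enlargement X lam B t"
    have "E \<inter> ?E \<noteq> {}" if "E \<in> filter_sets X G" for E
    proof -
      have "?\<mu> ` E \<in> filter_sets UNIV (filtermap ?\<mu> G)"
        using that by (auto simp: filter_sets_def eventually_filtermap elim: eventually_mono)
      with D(1) have "?\<mu> ` E \<inter> D \<noteq> {}" by (auto simp: grill_def)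
      then obtain y where "y \<in> E" "?\<mu> y \<in> D" by blast
      moreover from this D(2) have "?\<mu> y \<le> t" by (meson Sup_upper less_imp_le order.trans)
      ultimately show ?thesis using that by (auto simp: enlargement_def filter_sets_def)
    qed
    then have "mesh X (filter_sets X G) {?E}"
      by (auto simp: mesh_def grill_def filter_sets_def)
    with G have "adh X lam {?E} x \<le> lam G x"
      unfolding adh_def[of X lam "{?E}"] by (intro INF_lower) simp
    moreover have "?\<mu> x \<le> adh X lam {?E} x + t"
      using adh_enlargement assms \<open>x \<in> X\<close> by blast
    ultimately show ?thesis by (meson add_right_mono order.trans)
  qed
  then have "?\<mu> x \<le> lam G x + ?L"
  \<comment> \<open>A finite \<open>lam G x\<close> can be moved to the left, leaving
    \<open>t\<close> alone on the right for the density argument.\<close>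
  proof (cases "lam G x = top")
    case False
    assume *: "\<And>t. ?L < t \<Longrightarrow> ?\<mu> x \<le> lam G x + t"
    have "?\<mu> x - lam G x \<le> ?L"
      by (rule dense_ge) (use * False in \<open>simp add: ennreal_minus_le_iff\<close>)
    then show ?thesis using False by (simp add: ennreal_minus_le_iff)
  qed simp
  then show "lam_V (filtermap ?\<mu> G) (?\<mu> x) \<le> lam G x"
    by (simp add: lam_V_def tminus_le_iff)
qed simp

lemma (in approach_space) lower_Kuratowski_le_lower_Vietoris:
  assumes "A \<in> closed_sets X lam"
  shows "lower_Kuratowski X lam \<FF> A \<le> lower_Vietoris X lam \<FF> A"
  unfolding lower_Kuratowski_def Let_def
proof (rule SUP_least, rule dense_ge)
  fix x r assume "x \<in> A" and r: "lower_Vietoris X lam \<FF> A < r"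
  then have x: "x \<in> X" using assms closed_sets_subset by blast
  let ?C = "closed_sets X lam"
  define D where "D = {G \<in> filters_on X. lam G x \<le> r}"
  \<comment> \<open>The axiom on suprema of filters applies only to nonempty families.\<close>
  have "principal {x} \<in> D"
    using x point by (auto simp: D_def filters_on_def principal_eq_bot_iff)
  then have "D \<noteq> {}" by blast
  have "Sup D \<in> filters_on X"
    using \<open>D \<noteq> {}\<close> by (auto simp: D_def filters_on_def bot_unique intro!: Sup_least)
  have "lam (Sup D) x = (SUP G\<in>D. lam G x)"
    by (rule Sup_filters) (use \<open>D \<noteq> {}\<close> x in \<open>auto simp: D_def\<close>)
  then have lam_Sup: "lam (Sup D) x \<le> r" by (auto simp: D_def intro: SUP_least)
  have "U \<inter> \<Union>\<H> \<noteq> {}"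
    if U: "U \<in> filter_sets X (Sup D)" and \<H>: "\<H> \<in> grill ?C (filter_sets ?C \<FF>)" for U \<H>
  proof -
    let ?\<mu> = "adh X lam {X - U}"
    let ?s = "SUP \<A>\<in>filter_sets ?C \<FF>. INF C\<in>\<A>. vee ?\<mu> C"
    \<comment> \<open>Otherwise a filter containing \<open>X - U\<close> would belong to
      \<open>D\<close>, hence refine \<open>Sup D\<close> and contain \<open>U\<close> as
      well.\<close>
    have "r \<le> ?\<mu> x"
    proof (rule ccontr)
      assume "\<not> r \<le> ?\<mu> x"
      then obtain G where G: "G \<in> filters_on X" "eventually (\<lambda>y. y \<in> X - U) G" "lam G x < r"
        using filter_containing_of_adh_less[of "X - U" x r] x by (metis Diff_subset not_le)
      then have "G \<le> Sup D" by (auto simp: D_def intro: Sup_upper)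
      then have "eventually (\<lambda>y. y \<in> U) G" using U by (auto simp: filter_sets_def dest: filter_leD)
      with G(2) have "eventually (\<lambda>y. False) G" by eventually_elim simp
      with G(1) show False by (simp add: filters_on_def trivial_limit_def)
    qed
    also have "?\<mu> x \<le> vee ?\<mu> A" unfolding vee_def using \<open>x \<in> A\<close> by (rule SUP_upper)
    finally have "r \<le> vee ?\<mu> A" .
    have "vee ?\<mu> A \<ominus> ?s \<le> lower_Vietoris X lam \<FF> A"
      unfolding lower_Vietoris_def
      by (rule SUP_upper) (simp add: contractions_V_def contraction_adh)
    then have "?s = top \<or> vee ?\<mu> A \<le> lower_Vietoris X lam \<FF> A + ?s"
      unfolding tminus_le_iff .
    moreover have "\<not> vee ?\<mu> A \<le> lower_Vietoris X lam \<FF> A"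
      using r \<open>r \<le> vee ?\<mu> A\<close> by simp
    \<comment> \<open>With \<open>?s = 0\<close> nothing would be subtracted, and the Vietoris value
      would be at least \<open>vee ?\<mu> A\<close>, hence at least \<open>r\<close>.\<close>
    ultimately have "?s \<noteq> 0" by (metis add.right_neutral ennreal_zero_neq_top)
    then obtain \<A> where \<A>: "\<A> \<in> filter_sets ?C \<FF>" "(INF C\<in>\<A>. vee ?\<mu> C) \<noteq> 0"
      by (metis (no_types, lifting) SUP_bot_conv(2) bot_ennreal)
    from \<H> \<A>(1) obtain C where C: "C \<in> \<A>" "C \<in> \<H>" by (auto simp: grill_def)
    then have "vee ?\<mu> C \<noteq> 0" using \<A>(2) by (metis INF_lower le_zero_eq)
    then obtain y where y: "y \<in> C" "?\<mu> y \<noteq> 0"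
      by (auto simp: vee_def bot_ennreal[symmetric])
    have "C \<subseteq> X" using C(1) \<A>(1) closed_sets_subset by (auto simp: filter_sets_def)
    \<comment> \<open>The distance to \<open>X - U\<close> vanishes on \<open>X - U\<close>, so a
      point of \<open>X\<close> with nonzero distance lies in \<open>U\<close>.\<close>
    then have "y \<in> U" using y adh_eq_0[of "X - U" y] by blast
    then show ?thesis using y(1) C(2) by blast
  qed
  then have "mesh X (filter_sets X (Sup D)) (rdc (grill ?C (filter_sets ?C \<FF>)))"
    unfolding mesh_def grill_def[of X] rdc_def by (auto simp: filter_sets_def Int_commute)
  with \<open>Sup D \<in> filters_on X\<close>
  have "adh X lam (rdc (grill ?C (filter_sets ?C \<FF>))) x \<le> lam (Sup D) x"
    unfolding adh_def by (intro INF_lower) simp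
  also note lam_Sup
  finally show "adh X lam (rdc (grill ?C (filter_sets ?C \<FF>))) x \<le> r" .
qed

theorem theorem33:
  fixes X :: "'a set" and lam :: "'a filter \<Rightarrow> 'a \<Rightarrow> ennreal"
  assumes "convergence_approach_space X lam"
  shows "(\<forall>\<FF>\<in>filters_on (closed_sets X lam). \<forall>A\<in>closed_sets X lam.
            lower_Kuratowski X lam \<FF> A \<ge> lower_Vietoris X lam \<FF> A) \<and>
         (approach_space X lam \<longrightarrow>
           (\<forall>\<FF>\<in>filters_on (closed_sets X lam). \<forall>A\<in>closed_sets X lam.
              lower_Kuratowski X lam \<FF> A = lower_Vietoris X lam \<FF> A))"
proof (intro conjI impI ballI)
  fix \<FF> A
  assume A: "A \<in> closed_sets X lam"
  then show "lower_Vietoris X lam \<FF> A \<le> lower_Kuratowski X lam \<FF> A"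
    by (rule lower_Vietoris_le_lower_Kuratowski)
  assume "approach_space X lam"
  then have "lower_Kuratowski X lam \<FF> A \<le> lower_Vietoris X lam \<FF> A"
    using A by (rule approach_space.lower_Kuratowski_le_lower_Vietoris)
  with A show "lower_Kuratowski X lam \<FF> A = lower_Vietoris X lam \<FF> A"
    by (simp add: order.antisym lower_Vietoris_le_lower_Kuratowski)
qed

end
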